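(* The following hold. (a) For every non-empty set of primes $\mathcal{P}$ there exists a group $\Gamma$ such that, for every prime $p$, $\Gamma$ has commuting $\mathbb{Z}/p$-conjugates if and only if $p \in \mathcal{P}$. (b) There exists a group that has commuting cyclic conjugates, but does not have commuting $\mathbb{Z}/n$-conjugates for any integer $n \geq 2$. (c) In both (a) (for every non-empty set of primes $\mathcal{P}$) and (b), the group can be chosen so that, in addition, it does not have commuting $\mathbb{Z}$-conjugates.
   Context: Groups are abstract discrete groups, and we write ${}^t H = tHt^{-1}$. A group $\Gamma$ has *commuting cyclic conjugates* if for every finitely generated subgroup $H \leq \Gamma$ there exist $t \in \Gamma$ and $n \in \mathbb{Z}_{\geq 2} \cup \{\infty\}$ such that $[H, {}^{t^p} H] = 1$ for all integers $1 \leq p < n$ and $[H, t^n] = 1$, where $t^\infty$ is read as $1$. For an integer $n \geq 2$, $\Gamma$ has *commuting $\mathbb{Z}/n$-conjugates* if for every finitely generated subgroup $H \leq \Gamma$ there exists $t \in \Gamma$ such that $[H, {}^{t^p} H] = 1$ for all $1 \leq p < n$, and $[H, t^n] = 1$. $\Gamma$ has *commuting $\mathbb{Z}$-conjugates* if for every finitely generated subgroup $H \leq \Gamma$ there exists $t \in \Gamma$ such that $[H, {}^{t^p} H] = 1$ for all integers $p \geq 1$. *)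

theory Defs
  imports
    "HOL-Algebra.Coset"
    "HOL-Algebra.Generated_Groups"
    "HOL-Library.Extended_Nat"
    "HOL-Computational_Algebra.Primes"
begin

definition fg_subgroup :: "('a, 'b) monoid_scheme \<Rightarrow> 'a set \<Rightarrow> bool" where
  "fg_subgroup G H \<longleftrightarrow> (\<exists>S. finite S \<and> S \<subseteq> carrier G \<and> H = generate G S)"

definition commutator_subgroup :: "('a, 'b) monoid_scheme \<Rightarrow> 'a set \<Rightarrow> 'a set \<Rightarrow> 'a set" where
  "commutator_subgroup G A B =
     generate G {a \<otimes>\<^bsub>G\<^esub> b \<otimes>\<^bsub>G\<^esub> inv\<^bsub>G\<^esub> a \<otimes>\<^bsub>G\<^esub> inv\<^bsub>G\<^esub> b | a b. a \<in> A \<and> b \<in> B}"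

definition conj_subgroup :: "('a, 'b) monoid_scheme \<Rightarrow> 'a \<Rightarrow> 'a set \<Rightarrow> 'a set" where
  "conj_subgroup G t H = (t <#\<^bsub>G\<^esub> H) #>\<^bsub>G\<^esub> inv\<^bsub>G\<^esub> t"

(* The exponent n ranges over the naturals and infinity; t to the power infinity is 1. *)
definition enat_pow :: "('a, 'b) monoid_scheme \<Rightarrow> 'a \<Rightarrow> enat \<Rightarrow> 'a" where
  "enat_pow G t n = (case n of enat m \<Rightarrow> t [^]\<^bsub>G\<^esub> m | \<infinity> \<Rightarrow> \<one>\<^bsub>G\<^esub>)"

definition commuting_cyclic_conjugates :: "('a, 'b) monoid_scheme \<Rightarrow> bool" where
  "commuting_cyclic_conjugates G \<longleftrightarrow>
     (\<forall>H. fg_subgroup G H \<longrightarrow>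
       (\<exists>t\<in>carrier G. \<exists>n::enat. 2 \<le> n \<and>
         (\<forall>p::nat. 1 \<le> p \<and> enat p < n \<longrightarrow>
           commutator_subgroup G H (conj_subgroup G (t [^]\<^bsub>G\<^esub> p) H) = {\<one>\<^bsub>G\<^esub>}) \<and>
         commutator_subgroup G H {enat_pow G t n} = {\<one>\<^bsub>G\<^esub>}))"

(* Commuting Z/n-conjugates; meant for n at least 2. *)
definition commuting_Zmod_conjugates :: "('a, 'b) monoid_scheme \<Rightarrow> nat \<Rightarrow> bool" where
  "commuting_Zmod_conjugates G n \<longleftrightarrow>
     (\<forall>H. fg_subgroup G H \<longrightarrow>
       (\<exists>t\<in>carrier G.
         (\<forall>p::nat. 1 \<le> p \<and> p < n \<longrightarrow>
           commutator_subgroup G H (conj_subgroup G (t [^]\<^bsub>G\<^esub> p) H) = {\<one>\<^bsub>G\<^esub>}) \<and>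
         commutator_subgroup G H {t [^]\<^bsub>G\<^esub> n} = {\<one>\<^bsub>G\<^esub>}))"

definition commuting_Z_conjugates :: "('a, 'b) monoid_scheme \<Rightarrow> bool" where
  "commuting_Z_conjugates G \<longleftrightarrow>
     (\<forall>H. fg_subgroup G H \<longrightarrow>
       (\<exists>t\<in>carrier G.
         (\<forall>p::nat. 1 \<le> p \<longrightarrow>
           commutator_subgroup G H (conj_subgroup G (t [^]\<^bsub>G\<^esub> p) H) = {\<one>\<^bsub>G\<^esub>})))"

(*
  HOL cannot quantify existentially over types inside a formula, so the existence of a group
  is stated as the existence of a group whose elements are natural numbers. For the properties
  above, this is equivalent to the existence of a group of arbitrary cardinality: given a
  group G, choose for each failing property (countably many) a finitely generated subgroup
  witnessing the failure, and close the subgroup generated by all of them under a choice of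
  conjugating elements t (finitely generated subgroups of a countable group are countably many,
  so this stays countable after omega steps). The resulting countable subgroup has exactly
  the same properties among those considered, because a conjugating element found in a subgroup
  also serves in G; and every countable group has a copy on a set of natural numbers.
*)

end

theory Submission
  imports Defs "HOL-Combinatorics.Permutations" "HOL-Number_Theory.Cong" "HOL-Library.Countable_Set"
begin

text \<open>For a sequence of primes \<open>p\<^sub>0, p\<^sub>1, \<dots>\<close> let \<open>N\<^sub>m = 3 p\<^sub>0 \<cdots> p\<^sub>m\<^sub>-\<^sub>1\<close>, and let \<open>\<Gamma>\<close> be the union of the iterated
  wreath products \<open>S\<^sub>3 \<wr> \<int>/p\<^sub>0 \<wr> \<dots> \<wr> \<int>/p\<^sub>m\<^sub>-\<^sub>1\<close> acting on \<open>{..<N\<^sub>m}\<close>. The top generator of each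
  \<open>\<int>/p\<^sub>m\<close> shows that the elements supported in the first block of length \<open>N\<^sub>m\<close> have commuting
  \<open>\<int>/p\<^sub>m\<close>-conjugates. Conversely, let \<open>H\<close> be the finite non-abelian group of all elements supported in that
  block. If \<open>[H, \<^sup>tH] = 1\<close> then \<open>t\<close> moves the block, and if \<open>[H, t] = 1\<close> then \<open>t\<close> fixes it, so commuting
  \<open>\<int>/n\<close>-conjugates of \<open>H\<close> under \<open>t\<close> make \<open>n\<close> the length of the \<open>t\<close>-orbit of the block. This length is always
  finite, so there are no commuting \<open>\<int>\<close>-conjugates, and it divides a product of some \<open>p\<^sub>i\<close> with \<open>i \<ge> m\<close>. Repeating each prime of \<open>P\<close> infinitely often gives (a); using
  each prime exactly once gives (b), as \<open>m\<close> is arbitrary.\<close>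

section \<open>Preliminaries on commutators, copies of countable groups, and permutations\<close>

lemma (in group) commutator_subgroup_trivial_iff:
  assumes "A \<subseteq> carrier G" "B \<subseteq> carrier G"
  shows "commutator_subgroup G A B = {\<one>} \<longleftrightarrow> (\<forall>a\<in>A. \<forall>b\<in>B. a \<otimes> b = b \<otimes> a)"
proof -
  let ?C = "{a \<otimes> b \<otimes> inv a \<otimes> inv b | a b. a \<in> A \<and> b \<in> B}"
  have eq: "a \<otimes> b \<otimes> inv a \<otimes> inv b = \<one> \<longleftrightarrow> a \<otimes> b = b \<otimes> a"
    if "a \<in> carrier G" "b \<in> carrier G" for a b
  proof -
    have "a \<otimes> b \<otimes> inv a \<otimes> inv b = (a \<otimes> b) \<otimes> inv (b \<otimes> a)"
      using that by (simp add: inv_mult_group m_assoc)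
    then show ?thesis
      using that inv_solve_right'[of \<one> "a \<otimes> b" "b \<otimes> a"] by (simp add: eq_commute)
  qed
  have "generate G ?C = {\<one>} \<longleftrightarrow> ?C \<subseteq> {\<one>}"
  proof
    assume *: "generate G ?C = {\<one>}"
    show "?C \<subseteq> {\<one>}"
      unfolding *[symmetric] by (rule subsetI) (rule generate.incl)
  next
    \<comment> \<open>\<open>?C\<close> is empty when \<open>A\<close> or \<open>B\<close> is; the
      empty set also generates the trivial subgroup.\<close>
    assume "?C \<subseteq> {\<one>}"
    then have "?C = {} \<or> ?C = {\<one>}" by (rule subset_singletonD)
    then show "generate G ?C = {\<one>}"
      using generate_empty generate_one by (elim disjE) (simp_all only:)
  qed
  moreover have "?C \<subseteq> {\<one>} \<longleftrightarrow> (\<forall>a\<in>A. \<forall>b\<in>B. a \<otimes> b = b \<otimes> a)"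
  proof -
    have "?C \<subseteq> {\<one>} \<longleftrightarrow> (\<forall>a\<in>A. \<forall>b\<in>B. a \<otimes> b \<otimes> inv a \<otimes> inv b = \<one>)"
      by blast
    also have "\<dots> \<longleftrightarrow> (\<forall>a\<in>A. \<forall>b\<in>B. a \<otimes> b = b \<otimes> a)"
      using assms by (intro ball_cong refl eq) auto
    finally show ?thesis .
  qed
  ultimately show ?thesis
    unfolding commutator_subgroup_def by simp
qed

lemma conj_subgroup_eq_image: "conj_subgroup G t H = (\<lambda>h. t \<otimes>\<^bsub>G\<^esub> h \<otimes>\<^bsub>G\<^esub> inv\<^bsub>G\<^esub> t) ` H"
  unfolding conj_subgroup_def l_coset_def r_coset_def by auto

text \<open>Transport of structure along \<open>to_nat_on\<close>. The final theorem asks for groups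
  on \<open>nat\<close>, while the construction lives on functions.\<close>

lemma countable_group_nat_copy:
  assumes "group H" "countable (carrier H)"
  obtains G :: "nat monoid" and \<phi> where "group G" "\<phi> \<in> iso G H"
proof -
  interpret H: group H by fact
  define \<psi> where "\<psi> = from_nat_into (carrier H)"
  define \<nu> where "\<nu> = to_nat_on (carrier H)"
  have \<psi>\<nu> [simp]: "\<psi> (\<nu> x) = x" if "x \<in> carrier H" for x
    using that assms unfolding \<psi>_def \<nu>_def by simp
  define G where "G = \<lparr>carrier = \<nu> ` carrier H, monoid.mult = (\<lambda>a b. \<nu> (\<psi> a \<otimes>\<^bsub>H\<^esub> \<psi> b)), one = \<nu> \<one>\<^bsub>H\<^esub>\<rparr>"
  have "group G"
  proof (rule groupI)
    fix x assume "x \<in> carrier G"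
    then obtain a where "a \<in> carrier H" "x = \<nu> a" unfolding G_def by auto
    then show "\<exists>y\<in>carrier G. y \<otimes>\<^bsub>G\<^esub> x = \<one>\<^bsub>G\<^esub>"
      by (intro bexI[of _ "\<nu> (inv\<^bsub>H\<^esub> a)"]) (auto simp: G_def)
  qed (auto simp: G_def H.m_assoc)
  moreover have "\<psi> \<in> iso G H"
    unfolding iso_def hom_def bij_betw_def G_def
    by (auto simp: inj_on_def image_image)
  ultimately show thesis by (rule that)
qed

text \<open>By injectivity \<open>g\<close> also preserves the complement of \<open>S\<close>, so
  \<open>f\<close> and \<open>g\<close> have disjoint supports.\<close>

lemma permutes_comp_commute:
  assumes "f permutes S" "inj g" "\<And>x. x \<in> S \<Longrightarrow> g x = x"
  shows "f \<circ> g = g \<circ> f"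
proof
  fix x
  have "g x \<notin> S" if "x \<notin> S"
    using assms(2,3) that by (metis injD)
  then show "(f \<circ> g) x = (g \<circ> f) x"
    using assms(1,3) by (cases "x \<in> S") (auto simp: permutes_in_image permutes_not_in)
qed

lemma bij_imp_permutes_fixing:
  assumes "bij f" "\<And>x. x \<notin> S \<Longrightarrow> f x = x"
  shows "f permutes S"
  unfolding permutes_def using assms by (metis bij_pointE)

section \<open>The group of finitely supported permutations respecting the tower of blocks\<close>

locale block_tower =
  fixes p :: "nat \<Rightarrow> nat"
  assumes p_ge_2: "2 \<le> p i"
begin

definition N :: "nat \<Rightarrow> nat" where
  "N m = 3 * (\<Prod>i<m. p i)"

lemma p_pos: "0 < p i"
  using p_ge_2[of i] by simp

lemma N_Suc: "N (Suc m) = N m * p m"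
  by (simp add: N_def)

lemma N_pos: "0 < N m"
  by (simp add: N_def p_pos prod_pos)

lemma N_dvd: "m \<le> k \<Longrightarrow> N m dvd N k"
  by (induction k rule: dec_induct) (auto simp: N_Suc)

lemma N_mono: "m \<le> k \<Longrightarrow> N m \<le> N k"
  using N_dvd N_pos by (simp add: dvd_imp_le)

text \<open>Ensures that every finite support fits into some initial block.\<close>

lemma less_N: "m < N m"
proof (induction m)
  case (Suc m)
  have "N m * 2 \<le> N (Suc m)"
    using p_ge_2[of m] by (simp add: N_Suc)
  with Suc show ?case by linarith
qed (simp add: N_def)

lemma N_eq_Suc_mult:
  assumes "m < k"
  obtains r where "N k = N m * p m * r"
  using N_dvd[of "Suc m" k] assms by (auto simp: N_Suc dvd_def)

text \<open>Inside each block of length \<open>N (Suc m)\<close> the \<open>p m\<close> subblocks are permuted by a cyclic shift; the congruence is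
  arranged so that no subtraction occurs.\<close>

definition block_perms :: "(nat \<Rightarrow> nat) set" where
  "block_perms = {f. (\<exists>B. f permutes {..<B}) \<and>
     (\<forall>m x y. f x div N m = f y div N m \<longleftrightarrow> x div N m = y div N m) \<and>
     (\<forall>m x y. x div N (Suc m) = y div N (Suc m) \<longrightarrow>
        [f x div N m + y div N m = f y div N m + x div N m] (mod p m))}"

definition block_group :: "(nat \<Rightarrow> nat) monoid" where
  "block_group = \<lparr>carrier = block_perms, monoid.mult = (\<circ>), one = id\<rparr>"

lemma block_perms_support: "f \<in> block_perms \<Longrightarrow> \<exists>B. f permutes {..<B}"
  unfolding block_perms_def by blast

lemma block_perms_bij: "f \<in> block_perms \<Longrightarrow> bij f"
  using block_perms_support permutes_bij by blast

lemma block_perms_block: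
  "f \<in> block_perms \<Longrightarrow> f x div N m = f y div N m \<longleftrightarrow> x div N m = y div N m"
  unfolding block_perms_def by blast

lemma block_perms_shift:
  "f \<in> block_perms \<Longrightarrow> x div N (Suc m) = y div N (Suc m) \<Longrightarrow>
    [f x div N m + y div N m = f y div N m + x div N m] (mod p m)"
  unfolding block_perms_def by blast

lemma id_block_perms: "id \<in> block_perms"
  unfolding block_perms_def by (auto simp: permutes_id cong_def add.commute)

lemma comp_block_perms:
  assumes f: "f \<in> block_perms" and g: "g \<in> block_perms"
  shows "f \<circ> g \<in> block_perms"
proof -
  obtain A B where "f permutes {..<A}" "g permutes {..<B}"
    using f g block_perms_support by blast
  then have "f permutes {..<max A B}" "g permutes {..<max A B}"
    by (auto elim!: permutes_subset)
  then have "f \<circ> g permutes {..<max A B}"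
    by (rule permutes_compose[rotated])
  moreover have "[f (g x) div N m + y div N m = f (g y) div N m + x div N m] (mod p m)"
    if *: "x div N (Suc m) = y div N (Suc m)" for x y m
  proof -
    have "[f (g x) div N m + g y div N m = f (g y) div N m + g x div N m] (mod p m)"
      using f g * by (intro block_perms_shift) (simp_all add: block_perms_block)
    moreover have "[g x div N m + y div N m = g y div N m + x div N m] (mod p m)"
      using g * by (rule block_perms_shift)
    \<comment> \<open>In the sum of the two congruences the indices of \<open>g x\<close> and
      \<open>g y\<close> occur on both sides and cancel.\<close>
    ultimately have "[(f (g x) div N m + g y div N m) + (g x div N m + y div N m) =
        (f (g y) div N m + g x div N m) + (g y div N m + x div N m)] (mod p m)"
      by (rule cong_add)
    then have "[(f (g x) div N m + y div N m) + (g x div N m + g y div N m) =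
        (f (g y) div N m + x div N m) + (g x div N m + g y div N m)] (mod p m)"
      by (simp add: ac_simps)
    then show ?thesis
      by (simp only: cong_add_rcancel_nat)
  qed
  ultimately show ?thesis
    using f g unfolding block_perms_def by auto
qed

lemma inv_block_perms:
  assumes f: "f \<in> block_perms"
  shows "inv_into UNIV f \<in> block_perms"
proof -
  let ?g = "inv_into UNIV f"
  have fg [simp]: "f (?g x) = x" for x
    using block_perms_bij[OF f] by (simp add: bij_is_surj surj_f_inv_f)
  obtain B where "f permutes {..<B}"
    using f block_perms_support by blast
  then have "?g permutes {..<B}"
    by (rule permutes_inv)
  moreover have iff: "?g x div N m = ?g y div N m \<longleftrightarrow> x div N m = y div N m" for x y m
    using block_perms_block[OF f, of "?g x" m "?g y"] by simp
  moreover have "[?g x div N m + y div N m = ?g y div N m + x div N m] (mod p m)"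
    if "x div N (Suc m) = y div N (Suc m)" for x y m
    \<comment> \<open>The congruence for \<open>f\<close> at the preimages is the desired one with
      its sides swapped.\<close>
    using block_perms_shift[OF f, of "?g x" m "?g y"] that
    by (simp add: iff cong_sym_eq add.commute)
  ultimately show ?thesis
    unfolding block_perms_def by blast
qed

lemma funpow_block_perms: "f \<in> block_perms \<Longrightarrow> f ^^ k \<in> block_perms"
  by (induction k) (auto simp: id_block_perms comp_block_perms)

lemma group_block_group: "group block_group"
proof (rule groupI)
  fix f assume "f \<in> carrier block_group"
  then show "\<exists>g\<in>carrier block_group. g \<otimes>\<^bsub>block_group\<^esub> f = \<one>\<^bsub>block_group\<^esub>"
    by (intro bexI[of _ "inv_into UNIV f"])
       (auto simp: block_group_def inv_block_perms block_perms_bij bij_is_inj)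
qed (auto simp: block_group_def id_block_perms comp_block_perms o_assoc)

lemma block_group_simps [simp]:
  "carrier block_group = block_perms" "x \<otimes>\<^bsub>block_group\<^esub> y = x \<circ> y" "\<one>\<^bsub>block_group\<^esub> = id"
  by (simp_all add: block_group_def)

lemma inv_block_group [simp]:
  "f \<in> block_perms \<Longrightarrow> inv\<^bsub>block_group\<^esub> f = inv_into UNIV f"
  by (rule group.inv_equality[OF group_block_group])
     (simp_all add: inv_block_perms block_perms_bij bij_is_inj)

lemma countable_block_perms: "countable block_perms"
proof (rule countable_subset)
  show "block_perms \<subseteq> (\<Union>B. {f. f permutes {..<B}})"
    using block_perms_support by blast
  show "countable (\<Union>B::nat. {f. f permutes {..<B}})"
    by (rule countable_UN) (auto intro: countable_finite finite_permutations)
qed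

section \<open>The orbit of the initial block under one permutation\<close>

lemma lt_N_iff: "x < N m \<longleftrightarrow> x div N m = 0 div N m"
  using N_pos[of m] by (simp add: div_eq_0_iff)

text \<open>Since blocks go to blocks, the image of the single point 0 decides where the whole
  initial block goes. Hence \<open>f 0 < N m\<close> serves as the test that \<open>f\<close>
  preserves it.\<close>

lemma block_perms_lt_iff:
  assumes "f \<in> block_perms" "f 0 < N m"
  shows "f x < N m \<longleftrightarrow> x < N m"
  using block_perms_block[OF assms(1), of x m 0] assms(2) by (simp add: lt_N_iff)

lemma funpow_lt_iff:
  assumes "f \<in> block_perms" "f 0 < N m"
  shows "(f ^^ k) x < N m \<longleftrightarrow> x < N m"
  by (induction k) (simp_all add: block_perms_lt_iff[OF assms])

text \<open>Comparing each iterate with 0 in the shift condition shows that every application of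
  \<open>f\<close> adds the same amount \<open>f 0 div N m\<close> to the block index modulo
  \<open>p m\<close>. After \<open>p m\<close> applications the index is 0 modulo
  \<open>p m\<close>, and inside the larger block it is below \<open>p m\<close>.\<close>

lemma funpow_fixes_subblock:
  assumes f: "f \<in> block_perms" and f0: "f 0 < N (Suc m)"
  shows "(f ^^ p m) 0 < N m"
proof -
  have lt: "(f ^^ k) 0 < N (Suc m)" for k
    using funpow_lt_iff[OF f f0] N_pos by blast
  have "[(f ^^ k) 0 div N m = k * (f 0 div N m)] (mod p m)" for k
  proof (induction k)
    case (Suc k)
    have "[f ((f ^^ k) 0) div N m + 0 div N m = f 0 div N m + (f ^^ k) 0 div N m] (mod p m)"
      using lt[of k] by (intro block_perms_shift[OF f]) simp
    with cong_add[OF cong_refl Suc] show ?case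
      by (auto intro: cong_trans)
  qed simp
  from this[of "p m"] have "[(f ^^ p m) 0 div N m = 0] (mod p m)"
    by (simp add: cong_def)
  moreover have "(f ^^ p m) 0 div N m < p m"
    using lt[of "p m"] by (simp add: N_Suc less_mult_imp_div_less mult.commute)
  ultimately have "(f ^^ p m) 0 div N m = 0"
    by (simp add: cong_def)
  then show ?thesis
    by (simp add: lt_N_iff)
qed

text \<open>Descend from level \<open>M\<close> to \<open>m\<close>: the power that preserves the
  block one level up is itself raised to the power \<open>p m\<close>.\<close>

lemma funpow_fixes_block:
  assumes f: "f \<in> block_perms" and "m \<le> M" "f 0 < N M"
  shows "(f ^^ (\<Prod>i=m..<M. p i)) 0 < N m"
  using assms(2)
proof (induction m rule: inc_induct)
  case base
  then show ?case using assms(3) by simp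
next
  case (step m)
  have "(\<Prod>i=m..<M. p i) = p m * (\<Prod>i=Suc m..<M. p i)"
    using step.hyps by (simp add: prod.atLeast_Suc_lessThan)
  then show ?case
    using funpow_fixes_subblock[OF funpow_block_perms[OF f] step.IH]
    by (simp add: funpow_mult mult.commute)
qed

text \<open>Finite support makes \<open>f\<close> preserve a large enough initial block, from which
  the descent starts.\<close>

lemma obtain_block_return_time:
  assumes f: "f \<in> block_perms"
  obtains M where "m \<le> M" "(f ^^ (\<Prod>i=m..<M. p i)) 0 < N m"
proof -
  obtain B where B: "f permutes {..<B}"
    using f block_perms_support by blast
  define M where "M = max m B"
  have "B \<le> N M"
    using less_N[of M] by (simp add: M_def)
  then have "f permutes {..<N M}"
    using B by (auto elim!: permutes_subset)
  then have "f 0 < N M"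
    using permutes_in_image[of f "{..<N M}" 0] N_pos by simp
  then show thesis
    using f by (intro that[of M] funpow_fixes_block) (auto simp: M_def)
qed

text \<open>Division with remainder: \<open>f ^^ n\<close> preserves the block, so
  \<open>K mod n\<close> is a return time too and must vanish because \<open>n\<close> is the least
  positive one.\<close>

lemma block_period_dvd:
  assumes f: "f \<in> block_perms" and n: "0 < n" "(f ^^ n) 0 < N m"
    and least: "\<And>k. 1 \<le> k \<Longrightarrow> k < n \<Longrightarrow> \<not> (f ^^ k) 0 < N m"
    and K: "(f ^^ K) 0 < N m"
  shows "n dvd K"
proof -
  define x where "x = ((f ^^ n) ^^ (K div n)) 0"
  have x: "x < N m"
    unfolding x_def using funpow_lt_iff[OF funpow_block_perms[OF f] n(2)] N_pos by blast
  have "(f ^^ K) 0 = (f ^^ (K mod n + n * (K div n))) 0"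
    by simp
  also have "\<dots> = (f ^^ (K mod n)) x"
    unfolding x_def funpow_mult funpow_add by simp
  finally have "(f ^^ (K mod n)) x < N m"
    using K by simp
  then have "(f ^^ (K mod n)) 0 < N m"
    using block_perms_block[OF funpow_block_perms[OF f], of "K mod n" x m 0] x
    by (simp add: lt_N_iff)
  then have "K mod n = 0"
    using least[of "K mod n"] n(1) by (cases "K mod n = 0") auto
  then show ?thesis by auto
qed

section \<open>The rotation generating the top factor of order \<open>p M\<close>\<close>

definition cyc :: "nat \<Rightarrow> nat \<Rightarrow> nat" where
  "cyc M x = (if x < N (Suc M) then (x + N M) mod N (Suc M) else x)"

lemma funpow_cyc:
  "(cyc M ^^ k) x = (if x < N (Suc M) then (x + k * N M) mod N (Suc M) else x)"
  using N_pos[of "Suc M"]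
  by (induction k) (auto simp: cyc_def mod_simps ac_simps)

lemma cyc_order: "cyc M ^^ p M = id"
  by (rule ext) (auto simp: funpow_cyc N_Suc mult.commute)

text \<open>Having the inverse as a power of \<open>cyc M\<close> gives bijectivity, and later lets
  block preservation pass from \<open>cyc M\<close> to its inverse.\<close>

lemma cyc_inverse:
  "cyc M ^^ (p M - 1) \<circ> cyc M = id" "cyc M \<circ> cyc M ^^ (p M - 1) = id"
proof -
  obtain k where k: "p M = Suc k"
    using p_pos[of M] gr0_implies_Suc by blast
  show "cyc M ^^ (p M - 1) \<circ> cyc M = id"
    using cyc_order[of M] unfolding k by (simp add: funpow_Suc_right del: funpow.simps(2))
  show "cyc M \<circ> cyc M ^^ (p M - 1) = id"
    using cyc_order[of M] unfolding k by simp
qed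

lemma cyc_permutes: "cyc M permutes {..<N (Suc M)}"
proof (rule bij_imp_permutes_fixing)
  show "bij (cyc M)"
    using cyc_inverse by (rule o_bij)
qed (simp add: cyc_def)

text \<open>\<open>N m\<close> divides both the shift \<open>N M\<close> and the modulus
  \<open>N (Suc M)\<close>, so the rotation descends to block indices.\<close>

lemma cyc_div:
  assumes "m \<le> M" "x < N (Suc M)"
  shows "cyc M x div N m = (x div N m + N M div N m) mod (N (Suc M) div N m)"
proof -
  obtain r where r: "N M = N m * r"
    using N_dvd[OF assms(1)] by (auto simp: dvd_def)
  have *: "N (Suc M) = N m * (r * p M)"
    by (simp add: N_Suc r)
  have "((x + N m * r) mod (N m * (r * p M))) div N m = ((x + N m * r) div N m) mod (r * p M)"
    using N_pos[of m] by (subst mod_mult2_eq) simp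
  then show ?thesis
    using assms(2) N_pos[of m] unfolding cyc_def * by (simp add: r add.commute)
qed

text \<open>Above level \<open>M\<close> the whole support lies in the initial block and no index
  changes. At levels up to \<open>M\<close> the indices in the support rotate by the constant
  \<open>N M div N m\<close>, which keeps their differences modulo \<open>p m\<close>.\<close>

lemma cyc_block_perms: "cyc M \<in> block_perms"
proof -
  let ?c = "cyc M"
  \<comment> \<open>\<open>N k\<close> is a boundary between blocks of level \<open>m\<close>, so it
    cannot separate two points of one block.\<close>
  have same_side: "x < N k \<longleftrightarrow> y < N k" if "x div N m = y div N m" and mk: "m \<le> k" for x y m k
  proof -
    obtain r where r: "N k = N m * r"
      using N_dvd[OF mk] by (auto simp: dvd_def)
    have "z < N k \<longleftrightarrow> z div N m < r" for z
      unfolding r using N_pos[of m] by (simp add: div_less_iff_less_mult mult.commute)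
    then show ?thesis using that(1) by simp
  qed
  have c_lt: "?c x < N (Suc M) \<longleftrightarrow> x < N (Suc M)" for x
    using permutes_in_image[OF cyc_permutes] by simp
  have high: "?c x div N m = x div N m" if "\<not> m \<le> M" for x m
  proof (cases "x < N (Suc M)")
    case True
    then have "x < N m" "?c x < N m"
      using N_mono[of "Suc M" m] c_lt[of x] that by auto
    then show ?thesis by simp
  qed (simp add: cyc_def)
  have fwd: "?c x div N m = ?c y div N m" if eq: "x div N m = y div N m" for x y m
  proof (cases "m \<le> M \<and> x < N (Suc M)")
    case True
    then show ?thesis
      using same_side[OF eq, of "Suc M"] cyc_div[of m M] eq by simp
  next
    case False
    then consider "\<not> m \<le> M" | "m \<le> M" "\<not> x < N (Suc M)" by blast
    then show ?thesis
    proof cases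
      case 2
      then have "\<not> y < N (Suc M)" using same_side[OF eq, of "Suc M"] by simp
      with 2 eq show ?thesis by (simp add: cyc_def)
    qed (simp add: high eq)
  qed
  have fwd_pow: "(?c ^^ k) x div N m = (?c ^^ k) y div N m" if "x div N m = y div N m" for k x y m
  proof (induction k)
    case (Suc k)
    then show ?case using fwd[OF Suc] by simp
  qed (simp add: that)
  have inverse: "(?c ^^ (p M - 1)) (?c x) = x" for x
    using cyc_inverse(1)[of M] by (rule pointfree_idE)
  have "?c x div N m = ?c y div N m \<longleftrightarrow> x div N m = y div N m" for x y m
  proof
    assume "?c x div N m = ?c y div N m"
    from fwd_pow[OF this, of "p M - 1"] show "x div N m = y div N m"
      by (simp only: inverse)
  qed (rule fwd)
  moreover have "[?c x div N m + y div N m = ?c y div N m + x div N m] (mod p m)"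
    if eq: "x div N (Suc m) = y div N (Suc m)" for x y m
  proof (cases "m \<le> M \<and> x < N (Suc M)")
    case True
    then have m: "m \<le> M" and x: "x < N (Suc M)" and y: "y < N (Suc M)"
      using same_side[OF eq, of "Suc M"] by auto
    obtain r where r: "N (Suc M) = N m * p m * r"
      using N_eq_Suc_mult[of m "Suc M"] m by auto
    \<comment> \<open>The wrap-around is modulo \<open>p m * r\<close>, hence invisible modulo
      \<open>p m\<close>.\<close>
    have "[?c z div N m = z div N m + N M div N m] (mod p m)" if "z < N (Suc M)" for z
      unfolding cyc_div[OF m that] r using N_pos[of m]
      by (simp add: cong_def mult.assoc mod_mod_cancel)
    then have "[?c x div N m + y div N m = x div N m + N M div N m + y div N m] (mod p m)"
      "[?c y div N m + x div N m = y div N m + N M div N m + x div N m] (mod p m)"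
      using x y by (auto intro!: cong_add)
    moreover have "x div N m + N M div N m + y div N m = y div N m + N M div N m + x div N m"
      by simp
    ultimately show ?thesis
      by (simp only: cong_def)
  next
    case False
    then consider "\<not> m \<le> M" | "m \<le> M" "\<not> x < N (Suc M)" by blast
    then show ?thesis
    proof cases
      case 2
      then have "\<not> y < N (Suc M)" using same_side[OF eq, of "Suc M"] by simp
      with 2 show ?thesis by (simp add: cyc_def add.commute)
    qed (simp add: high add.commute)
  qed
  ultimately show ?thesis
    using cyc_permutes[of M] unfolding block_perms_def mem_Collect_eq
    by (intro conjI allI impI exI)
qed

text \<open>The conjugate of \<open>b\<close> is supported on block number \<open>k\<close> of
  length \<open>N M\<close>, which is disjoint from block 0.\<close>

lemma cyc_conj_fixes:
  assumes b: "b permutes {..<N M}" and k: "1 \<le> k" "k < p M" and x: "x < N M"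
  shows "((cyc M ^^ k) \<circ> b \<circ> inv_into UNIV (cyc M ^^ k)) x = x"
proof -
  let ?g = "cyc M ^^ k"
  have bij: "bij ?g"
    by (intro block_perms_bij funpow_block_perms cyc_block_perms)
  define y where "y = inv_into UNIV ?g x"
  have gy: "?g y = x"
    unfolding y_def using bij by (simp add: bij_is_surj surj_f_inv_f)
  have "\<not> y < N M"
  proof
    assume y: "y < N M"
    \<comment> \<open>As \<open>k < p M\<close>, the shift does not wrap around, so \<open>y\<close>
      would land in block \<open>k\<close> and not at \<open>x\<close>.\<close>
    have "y + k * N M < Suc k * N M" using y by simp
    also have "\<dots> \<le> N (Suc M)"
      using k(2) unfolding N_Suc by (simp only: mult.commute[of "N M"] mult_le_mono1 Suc_leI)
    finally have lt: "y + k * N M < N (Suc M)" .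
    then have "?g y = y + k * N M"
      by (simp add: funpow_cyc)
    moreover have "N M \<le> k * N M" using k(1) by simp
    ultimately show False using gy x by linarith
  qed
  then have "b y = y"
    using permutes_not_in[OF b] by simp
  then show ?thesis
    by (simp add: y_def[symmetric] gy)
qed

section \<open>The symmetric group on three points at the base of the tower\<close>

lemma permutes_block_perms:
  assumes "f permutes {..<3}"
  shows "f \<in> block_perms"
proof -
  \<comment> \<open>The points 0, 1, 2 share a block at every level, so no block index
    changes.\<close>
  have "f x div N m = x div N m" for x m
  proof (cases "x < 3")
    case True
    moreover have "f x < 3" using permutes_in_image[OF assms, of x] True by simp
    moreover have "3 \<le> N m" using N_mono[of 0 m] by (simp add: N_def)
    ultimately show ?thesis by simp
  qed (use permutes_not_in[OF assms] in simp)
  then show ?thesis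
    using assms unfolding block_perms_def by (auto simp: add.commute)
qed

lemma noncommuting_block_perms:
  obtains f g where "f \<in> block_perms" "g \<in> block_perms"
    "f permutes {..<N m}" "g permutes {..<N m}" "f \<circ> g \<noteq> g \<circ> f"
proof -
  let ?f = "Transposition.transpose (0::nat) 1" and ?g = "Transposition.transpose (1::nat) 2"
  have 3: "{..<3} \<subseteq> {..<N m}" using N_mono[of 0 m] by (simp add: N_def)
  have fg: "?f permutes {..<3}" "?g permutes {..<3}"
    by (auto intro!: permutes_swap_id)
  have "(?f \<circ> ?g) 0 \<noteq> (?g \<circ> ?f) 0"
    by (simp add: Transposition.transpose_def)
  then have "?f \<circ> ?g \<noteq> ?g \<circ> ?f" by (rule contrapos_nn) simp
  then show thesis
    by (rule that[OF permutes_block_perms permutes_block_perms permutes_subset permutes_subset,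
          OF fg fg(1) 3 fg(2) 3])
qed

end

section \<open>Transfer to an isomorphic copy, and its finitely generated subgroups\<close>

locale block_tower_copy = block_tower p + group G
  for p :: "nat \<Rightarrow> nat" and G :: "'a monoid" (structure) +
  fixes \<phi> :: "'a \<Rightarrow> nat \<Rightarrow> nat"
  assumes \<phi>_iso: "\<phi> \<in> iso G block_group"
begin

sublocale \<phi>: group_hom G block_group \<phi>
  using \<phi>_iso group_block_group is_group
  by (simp add: group_hom_def group_hom_axioms_def iso_def)

lemma \<phi>_image: "\<phi> ` carrier G = block_perms"
  using \<phi>_iso by (auto simp: iso_def bij_betw_def block_group_def)

lemma \<phi>_closed: "a \<in> carrier G \<Longrightarrow> \<phi> a \<in> block_perms"
  using \<phi>_image by blast

lemma \<phi>_eq_iff: "a \<in> carrier G \<Longrightarrow> b \<in> carrier G \<Longrightarrow> \<phi> a = \<phi> b \<longleftrightarrow> a = b"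
  using \<phi>_iso by (auto simp: iso_def bij_betw_def inj_on_def)

lemma \<phi>_mult: "a \<in> carrier G \<Longrightarrow> b \<in> carrier G \<Longrightarrow> \<phi> (a \<otimes> b) = \<phi> a \<circ> \<phi> b"
  by simp

lemma \<phi>_one: "\<phi> \<one> = id"
  by simp

lemma \<phi>_pow: "a \<in> carrier G \<Longrightarrow> \<phi> (a [^] (k::nat)) = \<phi> a ^^ k"
  by (induction k) (simp_all add: \<phi>_one \<phi>_mult funpow_Suc_right del: funpow.simps(2))

lemma \<phi>_inv [simp]: "a \<in> carrier G \<Longrightarrow> \<phi> (inv a) = inv_into UNIV (\<phi> a)"
  by (simp add: \<phi>_closed)

text \<open>Images of inverses are to simplify to \<open>inv_into\<close> terms, not to inverses in
  \<open>block_group\<close>.\<close>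

declare \<phi>.hom_inv [simp del]

lemma commute_iff:
  "a \<in> carrier G \<Longrightarrow> b \<in> carrier G \<Longrightarrow> a \<otimes> b = b \<otimes> a \<longleftrightarrow> \<phi> a \<circ> \<phi> b = \<phi> b \<circ> \<phi> a"
  by (metis \<phi>_eq_iff \<phi>_mult m_closed)

definition supported :: "nat \<Rightarrow> 'a set" where
  "supported B = {a \<in> carrier G. \<phi> a permutes {..<B}}"

lemma supported_subgroup: "subgroup (supported B) G"
proof (rule subgroupI)
  have "\<one> \<in> supported B" by (simp add: supported_def \<phi>_one permutes_id)
  then show "supported B \<noteq> {}" by blast
qed (auto simp: supported_def \<phi>_inv \<phi>_mult permutes_inv permutes_compose)

text \<open>Only finitely many permutations have support in \<open>{..<B}\<close>, so the subgroup
  generates itself as a finite set.\<close>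

lemma supported_fg: "fg_subgroup G (supported B)"
proof -
  have "finite (supported B)"
  proof (rule finite_imageD)
    show "finite (\<phi> ` supported B)"
      by (rule finite_subset[OF _ finite_permutations[of "{..<B}"]]) (auto simp: supported_def)
    show "inj_on \<phi> (supported B)"
      by (auto simp: inj_on_def supported_def \<phi>_eq_iff)
  qed
  moreover have "supported B = generate G (supported B)"
  proof
    show "supported B \<subseteq> generate G (supported B)"
      by (rule subsetI) (rule generate.incl)
  qed (intro generate_subgroup_incl supported_subgroup order_refl)
  ultimately show ?thesis
    unfolding fg_subgroup_def using subgroup.subset[OF supported_subgroup] by blast
qed

lemma fg_subgroup_supported:
  assumes "fg_subgroup G H"
  obtains B where "\<And>M. B \<le> M \<Longrightarrow> H \<subseteq> supported (N M)"
proof -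
  obtain S where S: "finite S" "S \<subseteq> carrier G" "H = generate G S"
    using assms unfolding fg_subgroup_def by blast
  have "\<forall>a\<in>S. \<exists>B. \<phi> a permutes {..<B}"
    using S(2) \<phi>_closed block_perms_support by blast
  then obtain b where b: "\<And>a. a \<in> S \<Longrightarrow> \<phi> a permutes {..<b a}"
    by metis
  \<comment> \<open>For empty \<open>S\<close> the value of \<open>Max\<close> is unspecified but
    harmless: the inclusion below is then vacuous.\<close>
  define B where "B = Max (b ` S)"
  have "S \<subseteq> supported B"
  proof
    fix a assume a: "a \<in> S"
    then have "{..<b a} \<subseteq> {..<B}"
      using S(1) by (auto simp: B_def intro: less_le_trans)
    then show "a \<in> supported B"
      using a b S(2) unfolding supported_def by (auto intro: permutes_subset)
  qed
  then have "H \<subseteq> supported B"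
    unfolding S(3) by (intro generate_subgroup_incl supported_subgroup)
  moreover have "supported B \<subseteq> supported (N M)" if "B \<le> M" for M
    using less_N[of M] that by (auto simp: supported_def elim!: permutes_subset)
  ultimately show thesis
    by (intro that) (rule order_trans)
qed

section \<open>Positive results: existence of commuting conjugates\<close>

lemma conj_closed: "t \<in> carrier G \<Longrightarrow> H \<subseteq> carrier G \<Longrightarrow> conj_subgroup G t H \<subseteq> carrier G"
  by (auto simp: conj_subgroup_eq_image)

text \<open>The witness is the element over \<open>cyc M\<close>: its first \<open>p M - 1\<close>
  powers carry the initial block to other blocks, so supports become disjoint.\<close>

lemma cyclic_conjugates_commute:
  assumes H: "H \<subseteq> supported (N M)"
  obtains t where "t \<in> carrier G" "t [^] p M = \<one>"
    "\<And>k. 1 \<le> k \<Longrightarrow> k < p M \<Longrightarrow> commutator_subgroup G H (conj_subgroup G (t [^] k) H) = {\<one>}"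
proof -
  have Hc: "H \<subseteq> carrier G" using H by (auto simp: supported_def)
  obtain t where t: "t \<in> carrier G" "\<phi> t = cyc M"
    using \<phi>_image cyc_block_perms by (metis imageE)
  have "\<phi> (t [^] p M) = \<phi> \<one>"
    using t by (simp add: \<phi>_pow cyc_order \<phi>_one)
  then have "t [^] p M = \<one>"
    using t \<phi>_eq_iff by blast
  moreover have "commutator_subgroup G H (conj_subgroup G (t [^] k) H) = {\<one>}"
    if k: "1 \<le> k" "k < p M" for k
  proof -
    have "a \<otimes> b = b \<otimes> a" if a: "a \<in> H" and b: "b \<in> conj_subgroup G (t [^] k) H" for a b
    proof -
      obtain h where h: "h \<in> H" "b = t [^] k \<otimes> h \<otimes> inv (t [^] k)"
        using b by (auto simp: conj_subgroup_eq_image)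
      have bc: "b \<in> carrier G" using b conj_closed[OF _ Hc] t by blast
      have hc: "h \<in> carrier G" and hp: "\<phi> h permutes {..<N M}"
        using h(1) H by (auto simp: supported_def)
      have "\<phi> b = (cyc M ^^ k) \<circ> \<phi> h \<circ> inv_into UNIV (cyc M ^^ k)"
        using h(2) hc t by (simp add: \<phi>_pow)
      then have "\<phi> b x = x" if "x \<in> {..<N M}" for x
        using cyc_conj_fixes[OF hp k, of x] that by (simp only: lessThan_iff)
      then have "\<phi> a \<circ> \<phi> b = \<phi> b \<circ> \<phi> a"
        using a H \<phi>_closed[OF bc]
        by (intro permutes_comp_commute[of _ "{..<N M}"])
           (auto simp: supported_def block_perms_bij bij_is_inj)
      then show ?thesis
        using a bc Hc by (subst commute_iff) auto
    qed
    then show ?thesis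
      using conj_closed[OF _ Hc] Hc t by (subst commutator_subgroup_trivial_iff) auto
  qed
  ultimately show thesis
    using t by (intro that)
qed

lemma commutator_with_one: "H \<subseteq> carrier G \<Longrightarrow> commutator_subgroup G H {\<one>} = {\<one>}"
  by (subst commutator_subgroup_trivial_iff) auto

lemma commuting_cyclic: "commuting_cyclic_conjugates G"
  unfolding commuting_cyclic_conjugates_def
proof (intro allI impI)
  fix H assume "fg_subgroup G H"
  then obtain B where HB: "H \<subseteq> supported (N B)"
    by (rule fg_subgroup_supported) blast
  then have Hc: "H \<subseteq> carrier G" by (auto simp: supported_def)
  obtain t where t: "t \<in> carrier G" "t [^] p B = \<one>"
    "\<And>k. 1 \<le> k \<Longrightarrow> k < p B \<Longrightarrow> commutator_subgroup G H (conj_subgroup G (t [^] k) H) = {\<one>}"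
    using cyclic_conjugates_commute[OF HB] by blast
  then show "\<exists>t\<in>carrier G. \<exists>n::enat. 2 \<le> n \<and>
         (\<forall>p::nat. 1 \<le> p \<and> enat p < n \<longrightarrow>
           commutator_subgroup G H (conj_subgroup G (t [^] p) H) = {\<one>}) \<and>
         commutator_subgroup G H {enat_pow G t n} = {\<one>}"
    using p_ge_2[of B] commutator_with_one[OF Hc]
    by (intro bexI[of _ t] exI[of _ "enat (p B)"]) (auto simp: enat_pow_def numeral_eq_enat)
qed

lemma commuting_Zmod:
  assumes "infinite {i. p i = n}"
  shows "commuting_Zmod_conjugates G n"
  unfolding commuting_Zmod_conjugates_def
proof (intro allI impI)
  fix H assume "fg_subgroup G H"
  then obtain B where B: "\<And>M. B \<le> M \<Longrightarrow> H \<subseteq> supported (N M)"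
    by (rule fg_subgroup_supported) blast
  \<comment> \<open>Since \<open>n\<close> recurs infinitely often, it occurs at a level high enough
    to contain \<open>H\<close>.\<close>
  obtain M where M: "B \<le> M" "p M = n"
    using assms unfolding infinite_nat_iff_unbounded_le by blast
  have HB: "H \<subseteq> supported (N M)"
    using B M(1) by blast
  then have Hc: "H \<subseteq> carrier G" by (auto simp: supported_def)
  obtain t where t: "t \<in> carrier G" "t [^] p M = \<one>"
    "\<And>k. 1 \<le> k \<Longrightarrow> k < p M \<Longrightarrow> commutator_subgroup G H (conj_subgroup G (t [^] k) H) = {\<one>}"
    using cyclic_conjugates_commute[OF HB] by blast
  then show "\<exists>t\<in>carrier G.
        (\<forall>p::nat. 1 \<le> p \<and> p < n \<longrightarrow>
           commutator_subgroup G H (conj_subgroup G (t [^] p) H) = {\<one>}) \<and>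
         commutator_subgroup G H {t [^] n} = {\<one>}"
    using M(2) commutator_with_one[OF Hc] by (intro bexI[of _ t]) auto
qed

section \<open>Negative results: restrictions on commuting conjugates\<close>

lemma supported_noncommuting:
  obtains a b where "a \<in> supported (N m)" "b \<in> supported (N m)" "a \<otimes> b \<noteq> b \<otimes> a"
proof -
  obtain f g where fg: "f \<in> block_perms" "g \<in> block_perms"
    "f permutes {..<N m}" "g permutes {..<N m}" "f \<circ> g \<noteq> g \<circ> f"
    by (rule noncommuting_block_perms)
  then obtain a b where "a \<in> carrier G" "\<phi> a = f" "b \<in> carrier G" "\<phi> b = g"
    using \<phi>_image by (metis imageE)
  with fg show thesis
    by (intro that[of a b]) (auto simp: supported_def commute_iff)
qed

text \<open>If \<open>t\<close> preserved the block, conjugation by \<open>t\<close> would map the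
  subgroup onto itself, and the subgroup would commute with itself, although it is not
  abelian.\<close>

lemma conj_commute_moves_block:
  assumes t: "t \<in> carrier G"
    and comm: "commutator_subgroup G (supported (N m)) (conj_subgroup G t (supported (N m))) = {\<one>}"
  shows "\<not> \<phi> t 0 < N m"
proof
  assume t0: "\<phi> t 0 < N m"
  let ?H = "supported (N m)"
  have Hc: "?H \<subseteq> carrier G" by (auto simp: supported_def)
  have conj: "inv t \<otimes> b \<otimes> t \<in> ?H" if b: "b \<in> ?H" for b
  proof -
    have bc: "b \<in> carrier G" and bp: "\<phi> b permutes {..<N m}"
      using b by (auto simp: supported_def)
    have fixes_outside: "\<phi> (inv t \<otimes> b \<otimes> t) x = x" if "x \<notin> {..<N m}" for x
    proof -
      have "\<phi> t x \<notin> {..<N m}"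
        using that block_perms_lt_iff[OF \<phi>_closed[OF t] t0, of x] by simp
      then have "\<phi> b (\<phi> t x) = \<phi> t x"
        using permutes_not_in[OF bp] by simp
      moreover have "inj (\<phi> t)"
        using block_perms_bij[OF \<phi>_closed[OF t]] by (rule bij_is_inj)
      ultimately show ?thesis
        using t bc by (simp add: \<phi>_mult \<phi>_inv)
    qed
    have "bij (\<phi> (inv t \<otimes> b \<otimes> t))"
      using t bc by (intro block_perms_bij \<phi>_closed) simp
    then have "\<phi> (inv t \<otimes> b \<otimes> t) permutes {..<N m}"
      using fixes_outside by (rule bij_imp_permutes_fixing)
    then show ?thesis
      using t bc by (simp add: supported_def)
  qed
  have "a \<otimes> b = b \<otimes> a" if a: "a \<in> ?H" and b: "b \<in> ?H" for a b
  proof -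
    have bc: "b \<in> carrier G" using b Hc by blast
    have "b = t \<otimes> (inv t \<otimes> b \<otimes> t) \<otimes> inv t"
      using t bc by (simp add: m_assoc[symmetric]) (simp add: m_assoc)
    then have "b \<in> conj_subgroup G t ?H"
      unfolding conj_subgroup_eq_image using conj[OF b] by blast
    then show ?thesis
      using comm a commutator_subgroup_trivial_iff[OF Hc conj_closed[OF t Hc]] by blast
  qed
  then show False
    using supported_noncommuting[of m] by metis
qed

text \<open>If \<open>a\<close> commutes with \<open>t\<close>, then \<open>t\<close> maps points
  moved by \<open>a\<close> to points moved by \<open>a\<close>. A nontrivial supported
  \<open>a\<close> moves some \<open>x\<close> in the block, so \<open>t\<close> sends
  \<open>x\<close> back into the block.\<close>

lemma commute_fixes_block:
  assumes t: "t \<in> carrier G"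
    and comm: "commutator_subgroup G (supported (N m)) {t} = {\<one>}"
  shows "\<phi> t 0 < N m"
proof -
  obtain a b where ab: "a \<in> supported (N m)" "b \<in> supported (N m)" "a \<otimes> b \<noteq> b \<otimes> a"
    by (rule supported_noncommuting)
  then have ac: "a \<in> carrier G" and ap: "\<phi> a permutes {..<N m}" and bc: "b \<in> carrier G"
    by (auto simp: supported_def)
  \<comment> \<open>The identity would commute with \<open>b\<close>.\<close>
  have "\<phi> a \<noteq> id"
    using ab(3) ac bc by (auto simp: commute_iff)
  then obtain x where x: "\<phi> a x \<noteq> x" by (auto simp: fun_eq_iff)
  have "supported (N m) \<subseteq> carrier G" by (auto simp: supported_def)
  then have "a \<otimes> t = t \<otimes> a"
    using comm ab(1) t by (simp add: commutator_subgroup_trivial_iff)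
  then have "\<phi> a (\<phi> t x) = \<phi> t (\<phi> a x)"
    using ac t by (simp add: commute_iff fun_eq_iff)
  also have "\<dots> \<noteq> \<phi> t x"
    using x block_perms_bij[OF \<phi>_closed[OF t]] by (simp add: bij_is_inj inj_eq)
  finally have "\<phi> t x < N m"
    using permutes_not_in[OF ap] by force
  moreover have "x < N m"
    using permutes_not_in[OF ap] x by force
  ultimately show ?thesis
    using block_perms_block[OF \<phi>_closed[OF t], of x m 0] by (simp add: lt_N_iff)
qed

text \<open>For the subgroup supported in the initial block, \<open>n\<close> is the first return
  time of that block under \<open>t\<close>; it divides the return time supplied by the descent. The
  level \<open>m\<close> is free.\<close>

lemma commuting_Zmod_imp_dvd:
  assumes "commuting_Zmod_conjugates G n" "0 < n"
  obtains M where "n dvd (\<Prod>i=m..<M. p i)"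
proof -
  let ?H = "supported (N m)"
  obtain t where t: "t \<in> carrier G"
    and conj: "\<forall>k::nat. 1 \<le> k \<and> k < n \<longrightarrow>
      commutator_subgroup G ?H (conj_subgroup G (t [^] k) ?H) = {\<one>}"
    and comm: "commutator_subgroup G ?H {t [^] n} = {\<one>}"
    using assms(1)[unfolded commuting_Zmod_conjugates_def, rule_format, OF supported_fg[of "N m"]]
    by (elim bexE conjE)
  obtain M where M: "m \<le> M" "(\<phi> t ^^ (\<Prod>i=m..<M. p i)) 0 < N m"
    by (rule obtain_block_return_time[OF \<phi>_closed[OF t]])
  have "n dvd (\<Prod>i=m..<M. p i)"
  proof (rule block_period_dvd[OF \<phi>_closed[OF t] assms(2)])
    show "(\<phi> t ^^ n) 0 < N m"
      using commute_fixes_block[OF nat_pow_closed[OF t] comm] \<phi>_pow[OF t] by simp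
    show "\<not> (\<phi> t ^^ k) 0 < N m" if "1 \<le> k" "k < n" for k
      using conj_commute_moves_block[OF nat_pow_closed[OF t] conj[rule_format, OF conjI, OF that]]
        \<phi>_pow[OF t] by simp
  qed (rule M(2))
  then show thesis by (rule that)
qed

lemma not_commuting_Z: "\<not> commuting_Z_conjugates G"
proof
  let ?H = "supported (N 0)"
  assume "commuting_Z_conjugates G"
  then obtain t where t: "t \<in> carrier G"
    and conj: "\<forall>k::nat. 1 \<le> k \<longrightarrow>
      commutator_subgroup G ?H (conj_subgroup G (t [^] k) ?H) = {\<one>}"
    unfolding commuting_Z_conjugates_def by (metis supported_fg)
  obtain M where "0 \<le> M" and M: "(\<phi> t ^^ (\<Prod>i=0..<M. p i)) 0 < N 0"
    by (rule obtain_block_return_time[OF \<phi>_closed[OF t]])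
  \<comment> \<open>A positive return time is an exponent at which commuting conjugates
    fail.\<close>
  have "1 \<le> (\<Prod>i=0..<M. p i)"
    using prod_pos[of "{0..<M}" p] p_pos by (simp add: Suc_leI)
  from conj_commute_moves_block[OF nat_pow_closed[OF t] conj[rule_format, OF this]] M
  show False
    using \<phi>_pow[OF t] by simp
qed

lemma prime_dvd_commuting_Zmod:
  assumes primes: "\<And>i. prime (p i)"
    and "commuting_Zmod_conjugates G n" "0 < n" "prime q" "q dvd n"
  shows "\<exists>i\<ge>m. p i = q"
proof -
  obtain M where "n dvd (\<Prod>i=m..<M. p i)"
    using assms(2,3) by (rule commuting_Zmod_imp_dvd)
  then have "q dvd (\<Prod>i=m..<M. p i)"
    using assms(5) dvd_trans by blast
  then obtain i where "i \<in> {m..<M}" "q dvd p i"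
    using assms(4) by (auto simp: prime_dvd_prod_iff)
  then show ?thesis
    using primes assms(4) primes_dvd_imp_eq by (metis atLeastLessThan_iff)
qed

end

section \<open>Choosing the sequence of primes\<close>

lemma prime_sequence_group:
  fixes p :: "nat \<Rightarrow> nat"
  assumes primes: "\<And>i. prime (p i)"
  obtains G :: "nat monoid" where "group G" "commuting_cyclic_conjugates G"
    "\<not> commuting_Z_conjugates G"
    "\<forall>n. infinite {i. p i = n} \<longrightarrow> commuting_Zmod_conjugates G n"
    "\<forall>n q m. commuting_Zmod_conjugates G n \<longrightarrow> 0 < n \<longrightarrow> prime q \<longrightarrow> q dvd n \<longrightarrow> (\<exists>i\<ge>m. p i = q)"
proof -
  interpret block_tower p
    using primes by unfold_locales (rule prime_ge_2_nat)
  have "countable (carrier block_group)"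
    by (simp add: block_group_def countable_block_perms)
  with group_block_group obtain G :: "nat monoid" and \<phi> where G: "group G" "\<phi> \<in> iso G block_group"
    by (rule countable_group_nat_copy)
  then interpret group G by simp
  interpret block_tower_copy p G \<phi>
    using G(2) by unfold_locales
  show thesis
  proof (rule that[OF is_group commuting_cyclic not_commuting_Z]; intro allI impI)
    show "commuting_Zmod_conjugates G n" if "infinite {i. p i = n}" for n
      using that by (rule commuting_Zmod)
    show "\<exists>i\<ge>m. p i = q"
      if "commuting_Zmod_conjugates G n" "0 < n" "prime q" "q dvd n" for n q m
      using prime_dvd_commuting_Zmod[OF primes that] .
  qed
qed

text \<open>Enumerate by the first component of a decoded pair; the second component runs freely and
  repeats each value infinitely often.\<close>

lemma infinitely_repeating_enumeration:
  assumes "P \<noteq> {}" "countable P"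
  obtains p :: "nat \<Rightarrow> 'a" where "range p = P" "\<And>x. x \<in> P \<Longrightarrow> infinite {i. p i = x}"
proof
  define p where "p i = from_nat_into P (fst (prod_decode i))" for i
  show "range p = P"
  proof
    show "range p \<subseteq> P"
      using from_nat_into[OF assms(1)] by (auto simp: p_def)
    show "P \<subseteq> range p"
    proof
      fix x assume "x \<in> P"
      then have "p (prod_encode (to_nat_on P x, 0)) = x"
        using assms by (simp add: p_def)
      then show "x \<in> range p" by (metis rangeI)
    qed
  qed
  show "infinite {i. p i = x}" if "x \<in> P" for x
  proof -
    have "range (\<lambda>j. prod_encode (to_nat_on P x, j)) \<subseteq> {i. p i = x}"
      using assms that by (auto simp: p_def)
    moreover have "infinite (range (\<lambda>j. prod_encode (to_nat_on P x, j)))"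
      by (intro range_inj_infinite) (auto simp: inj_on_def)
    ultimately show ?thesis by (rule infinite_super)
  qed
qed

theorem proposition3p3:
  "(\<forall>P::nat set. P \<noteq> {} \<and> (\<forall>p\<in>P. prime p) \<longrightarrow>
      (\<exists>G::nat monoid. group G \<and>
        (\<forall>p::nat. prime p \<longrightarrow> (commuting_Zmod_conjugates G p \<longleftrightarrow> p \<in> P)))) \<and>
   (\<exists>G::nat monoid. group G \<and> commuting_cyclic_conjugates G \<and>
      (\<forall>n::nat. 2 \<le> n \<longrightarrow> \<not> commuting_Zmod_conjugates G n)) \<and>
   ((\<forall>P::nat set. P \<noteq> {} \<and> (\<forall>p\<in>P. prime p) \<longrightarrow>
      (\<exists>G::nat monoid. group G \<and>
        (\<forall>p::nat. prime p \<longrightarrow> (commuting_Zmod_conjugates G p \<longleftrightarrow> p \<in> P)) \<and>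
        \<not> commuting_Z_conjugates G)) \<and>
    (\<exists>G::nat monoid. group G \<and> commuting_cyclic_conjugates G \<and>
      (\<forall>n::nat. 2 \<le> n \<longrightarrow> \<not> commuting_Zmod_conjugates G n) \<and>
      \<not> commuting_Z_conjugates G))"
proof -
  \<comment> \<open>Facts \<open>a\<close> and \<open>b\<close> already include the clause of (c);
    (a) and (b) follow by dropping it.\<close>
  have a: "\<exists>G::nat monoid. group G \<and>
        (\<forall>p::nat. prime p \<longrightarrow> (commuting_Zmod_conjugates G p \<longleftrightarrow> p \<in> P)) \<and>
        \<not> commuting_Z_conjugates G" if P: "P \<noteq> {}" "\<forall>p\<in>P. prime p" for P :: "nat set"
  proof -
    obtain p :: "nat \<Rightarrow> nat" where p: "range p = P" "\<And>x. x \<in> P \<Longrightarrow> infinite {i. p i = x}"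
      using infinitely_repeating_enumeration[OF P(1) countableI_type] by blast
    have prime_p: "prime (p i)" for i using p(1) P(2) by blast
    obtain G :: "nat monoid" where G: "group G" "commuting_cyclic_conjugates G"
      "\<not> commuting_Z_conjugates G"
      "\<forall>n. infinite {i. p i = n} \<longrightarrow> commuting_Zmod_conjugates G n"
      "\<forall>n q m. commuting_Zmod_conjugates G n \<longrightarrow> 0 < n \<longrightarrow> prime q \<longrightarrow> q dvd n \<longrightarrow> (\<exists>i\<ge>m. p i = q)"
      by (rule prime_sequence_group[of p, OF prime_p])
    have "commuting_Zmod_conjugates G q \<longleftrightarrow> q \<in> P" if "prime q" for q
    proof
      assume "commuting_Zmod_conjugates G q"
      from G(5)[rule_format, OF this prime_gt_0_nat[OF that] that dvd_refl, of 0]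
      show "q \<in> P" using p(1) by blast
    qed (rule G(4)[rule_format, OF p(2)])
    with G(1,3) show ?thesis by (intro exI[of _ G] conjI allI impI)
  qed
  have b: "\<exists>G::nat monoid. group G \<and> commuting_cyclic_conjugates G \<and>
      (\<forall>n::nat. 2 \<le> n \<longrightarrow> \<not> commuting_Zmod_conjugates G n) \<and>
      \<not> commuting_Z_conjugates G"
  proof -
    define p where "p = enumerate {q::nat. prime q}"
    have inj: "inj p"
      unfolding p_def using inj_enumerate primes_infinite by blast
    have prime_p: "prime (p i)" for i
      using enumerate_in_set[OF primes_infinite] by (simp add: p_def)
    obtain G :: "nat monoid" where G: "group G" "commuting_cyclic_conjugates G"
      "\<not> commuting_Z_conjugates G"
      "\<forall>n. infinite {i. p i = n} \<longrightarrow> commuting_Zmod_conjugates G n"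
      "\<forall>n q m. commuting_Zmod_conjugates G n \<longrightarrow> 0 < n \<longrightarrow> prime q \<longrightarrow> q dvd n \<longrightarrow> (\<exists>i\<ge>m. p i = q)"
      by (rule prime_sequence_group[of p, OF prime_p])
    have "\<not> commuting_Zmod_conjugates G n" if n: "2 \<le> n" for n
    proof
      assume comm: "commuting_Zmod_conjugates G n"
      obtain q where q: "prime q" "q dvd n"
        using n prime_factor_nat[of n] by auto
      \<comment> \<open>A prime factor of \<open>n\<close> occurs at some index \<open>i\<close> and
        again beyond \<open>i\<close>, against the injectivity of \<open>p\<close>.\<close>
      obtain i where "p i = q"
        using G(5)[rule_format, OF comm _ q, of 0] n by auto
      moreover obtain j where "j \<ge> Suc i" "p j = q"
        using G(5)[rule_format, OF comm _ q, of "Suc i"] n by auto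
      ultimately have "i = j" "Suc i \<le> j"
        using injD[OF inj, of i j] by simp_all
      then show False by simp
    qed
    with G(1-3) show ?thesis by (intro exI[of _ G] conjI allI impI)
  qed
  show ?thesis
  proof (intro conjI allI impI)
    fix P :: "nat set"
    assume "P \<noteq> {} \<and> (\<forall>p\<in>P. prime p)"
    then obtain G :: "nat monoid" where G: "group G"
      "\<forall>p::nat. prime p \<longrightarrow> (commuting_Zmod_conjugates G p \<longleftrightarrow> p \<in> P)"
      "\<not> commuting_Z_conjugates G"
      using a by (elim conjE) (drule (1) a, elim exE conjE)
    show "\<exists>G::nat monoid. group G \<and>
        (\<forall>p::nat. prime p \<longrightarrow> (commuting_Zmod_conjugates G p \<longleftrightarrow> p \<in> P))"
      by (intro exI[of _ G] conjI G(1,2))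
    show "\<exists>G::nat monoid. group G \<and>
        (\<forall>p::nat. prime p \<longrightarrow> (commuting_Zmod_conjugates G p \<longleftrightarrow> p \<in> P)) \<and>
        \<not> commuting_Z_conjugates G"
      by (intro exI[of _ G] conjI G)
  next
    obtain G :: "nat monoid" where G: "group G" "commuting_cyclic_conjugates G"
      "\<forall>n::nat. 2 \<le> n \<longrightarrow> \<not> commuting_Zmod_conjugates G n"
      using b by (elim exE conjE)
    show "\<exists>G::nat monoid. group G \<and> commuting_cyclic_conjugates G \<and>
      (\<forall>n::nat. 2 \<le> n \<longrightarrow> \<not> commuting_Zmod_conjugates G n)"
      by (intro exI[of _ G] conjI G)
  qed (rule b)
qed

end
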